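(* Let $v: G \rightarrow [0,\infty[$ be a bounded weight on a planar domain $G$ such that the space $H^\infty_v(G)$ is normed. Then $H^\infty_v(G)$ is complete if and only if there is a bounded, continuous, strictly positive weight $\tilde{v}$ on $G$ such that $H^\infty_v(G)=H^\infty_{\tilde{v}}(G)$.
   Context: A planar domain is a (nonempty) open connected subset $G$ of $\mathbb{C}$. A weight on $G$ is an arbitrary function $v:G\to[0,\infty[$ (not assumed continuous, bounded, or strictly positive unless stated). $H(G)$ is the space of holomorphic functions on $G$. For a weight $v$, $H^\infty_v(G):=\{f\in H(G) : \|f\|_v:=\sup_{z\in G} v(z)|f(z)|<+\infty\}$, endowed with the seminorm $\|\cdot\|_v$. "$H^\infty_v(G)$ is normed" means that $\|\cdot\|_v$ is a norm on $H^\infty_v(G)$. The equality $H^\infty_v(G)=H^\infty_{\tilde v}(G)$ is equality of the two spaces of functions. *)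

theory Defs
  imports "HOL-Complex_Analysis.Complex_Analysis"
begin

definition planar_domain :: "complex set \<Rightarrow> bool" where
  "planar_domain G \<longleftrightarrow> open G \<and> connected G \<and> G \<noteq> {}"

text \<open>A function on \<open>G\<close> is represented by a total function. The values of a weight off \<open>G\<close> are
  irrelevant, whereas the members of \<open>holo_space G\<close> vanish off \<open>G\<close>, so that a holomorphic
  function on \<open>G\<close> has exactly one representative and a norm can separate points.\<close>

definition weight_on :: "complex set \<Rightarrow> (complex \<Rightarrow> real) \<Rightarrow> bool" where
  "weight_on G v \<longleftrightarrow> (\<forall>z\<in>G. 0 \<le> v z)"

definition holo_space :: "complex set \<Rightarrow> (complex \<Rightarrow> complex) set" where
  "holo_space G = {f. f holomorphic_on G \<and> (\<forall>z. z \<notin> G \<longrightarrow> f z = 0)}"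

definition weighted_sup :: "complex set \<Rightarrow> (complex \<Rightarrow> real) \<Rightarrow> (complex \<Rightarrow> complex) \<Rightarrow> ennreal" where
  "weighted_sup G v f = (SUP z\<in>G. ennreal (v z * cmod (f z)))"

definition Hinf :: "complex set \<Rightarrow> (complex \<Rightarrow> real) \<Rightarrow> (complex \<Rightarrow> complex) set" where
  "Hinf G v = {f \<in> holo_space G. weighted_sup G v f < \<infinity>}"

definition wnorm :: "complex set \<Rightarrow> (complex \<Rightarrow> real) \<Rightarrow> (complex \<Rightarrow> complex) \<Rightarrow> real" where
  "wnorm G v f = enn2real (weighted_sup G v f)"

definition is_norm_on :: "(complex \<Rightarrow> complex) set \<Rightarrow> ((complex \<Rightarrow> complex) \<Rightarrow> real) \<Rightarrow> bool" where
  "is_norm_on S N \<longleftrightarrow>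
     (\<forall>f\<in>S. 0 \<le> N f) \<and>
     (\<forall>f\<in>S. N f = 0 \<longleftrightarrow> f = (\<lambda>z. 0)) \<and>
     (\<forall>c. \<forall>f\<in>S. N (\<lambda>z. c * f z) = cmod c * N f) \<and>
     (\<forall>f\<in>S. \<forall>g\<in>S. N (\<lambda>z. f z + g z) \<le> N f + N g)"

definition Hinf_normed :: "complex set \<Rightarrow> (complex \<Rightarrow> real) \<Rightarrow> bool" where
  "Hinf_normed G v \<longleftrightarrow> is_norm_on (Hinf G v) (wnorm G v)"

definition wdist :: "complex set \<Rightarrow> (complex \<Rightarrow> real) \<Rightarrow> (complex \<Rightarrow> complex) \<Rightarrow> (complex \<Rightarrow> complex) \<Rightarrow> real" where
  "wdist G v f g = wnorm G v (\<lambda>z. f z - g z)"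

text \<open>\<open>Metric_space.mcomplete\<close> has its intended meaning only where \<open>wdist G v\<close> is a metric on
  \<open>Hinf G v\<close>, that is, for \<open>Hinf_normed G v\<close>; see \<open>Hinf_metric_space\<close> below.\<close>

definition Hinf_complete :: "complex set \<Rightarrow> (complex \<Rightarrow> real) \<Rightarrow> bool" where
  "Hinf_complete G v \<longleftrightarrow> Metric_space.mcomplete (Hinf G v) (wdist G v)"

lemma Hinf_diff:
  assumes "weight_on G v" "f \<in> Hinf G v" "g \<in> Hinf G v"
  shows "(\<lambda>z. f z - g z) \<in> Hinf G v"
proof -
  have "weighted_sup G v (\<lambda>z. f z - g z) \<le> weighted_sup G v f + weighted_sup G v g"
    unfolding weighted_sup_def
  proof (rule SUP_least)
    fix z assume z: "z \<in> G"
    have v: "0 \<le> v z" using assms(1) z by (simp add: weight_on_def)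
    have "v z * cmod (f z - g z) \<le> v z * cmod (f z) + v z * cmod (g z)"
      using mult_left_mono[OF norm_triangle_ineq4 v, of "f z" "g z"] by (simp add: distrib_left)
    then have "ennreal (v z * cmod (f z - g z)) \<le> ennreal (v z * cmod (f z)) + ennreal (v z * cmod (g z))"
      using v by (simp flip: ennreal_plus)
    also have "\<dots> \<le> (SUP z\<in>G. ennreal (v z * cmod (f z))) + (SUP z\<in>G. ennreal (v z * cmod (g z)))"
      using z by (intro add_mono SUP_upper)
    finally show "ennreal (v z * cmod (f z - g z)) \<le> \<dots>" .
  qed
  also have "\<dots> < \<infinity>" using assms(2,3) by (simp add: Hinf_def)
  finally show ?thesis
    using assms(2,3) by (auto simp: Hinf_def holo_space_def intro: holomorphic_on_diff)
qed

lemma Hinf_metric_space: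
  assumes "weight_on G v" "Hinf_normed G v"
  shows "Metric_space (Hinf G v) (wdist G v)"
proof
  fix f g h
  show "0 \<le> wdist G v f g" by (simp add: wdist_def wnorm_def)
  show "wdist G v f g = wdist G v g f"
    by (simp add: wdist_def wnorm_def weighted_sup_def norm_minus_commute)
  note N = assms(2)[unfolded Hinf_normed_def is_norm_on_def]
  show "wdist G v f g = 0 \<longleftrightarrow> f = g" if "f \<in> Hinf G v" "g \<in> Hinf G v"
    using N Hinf_diff[OF assms(1) that] by (auto simp: wdist_def fun_eq_iff)
  show "wdist G v f h \<le> wdist G v f g + wdist G v g h"
    if "f \<in> Hinf G v" "g \<in> Hinf G v" "h \<in> Hinf G v"
  proof -
    have tri: "\<forall>f\<in>Hinf G v. \<forall>g\<in>Hinf G v. wnorm G v (\<lambda>z. f z + g z) \<le> wnorm G v f + wnorm G v g"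
      using N by blast
    have "wnorm G v (\<lambda>z. (f z - g z) + (g z - h z)) \<le> wnorm G v (\<lambda>z. f z - g z) + wnorm G v (\<lambda>z. g z - h z)"
      using tri[rule_format, OF Hinf_diff[OF assms(1) that(1,2)] Hinf_diff[OF assms(1) that(2,3)]] .
    then show ?thesis by (simp add: wdist_def)
  qed
qed

end

theory Submission
  imports Defs
begin

text \<open>
  Both properties in the theorem are equivalent to a third one, \<open>controls_compacta G v\<close>: on each
  compact subset of \<open>G\<close>, the functions in the unit ball of \<open>Hinf G v\<close> are uniformly bounded. In
  other words, the inclusion of \<open>Hinf G v\<close> into the space of all holomorphic functions, with
  locally uniform convergence, is continuous.

  If the norm controls compact sets, then a Cauchy sequence converges locally uniformly, and the
  weighted inequalities pass to the limit, so the space is complete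
  (\<open>controls_compacta_imp_complete\<close>). Moreover the associated weight, the reciprocal of
  \<open>S z = sup cmod (f z)\<close> over the unit ball, is positive because \<open>S\<close> is finite, bounded because
  the unit ball contains a nonzero constant (here the boundedness of \<open>v\<close> enters), and continuous
  because a locally bounded family of holomorphic functions is locally equi-Lipschitz. It defines
  the same space (\<open>controls_compacta_imp_continuous_weight\<close>).

  If the space is complete, control on compact sets is a closed graph theorem
  (\<open>complete_imp_controls_compacta\<close>). The graph is closed since a function that
  vanishes wherever \<open>v\<close> is positive has norm zero, and hence is zero. The proof is the classical
  one: Baire's theorem gives approximations, and these are summed with the errors controlled on
  growing compact sets.

  Suppose finally that \<open>Hinf G v = Hinf G w\<close> with \<open>w\<close> bounded, continuous and positive. A gliding
  hump argument shows that \<open>w\<close> times \<open>cmod f\<close> is bounded uniformly over all \<open>f\<close> that are bounded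
  by \<open>1\<close> both in the norm of \<open>v\<close> and on one suitable compact set
  (\<open>equal_spaces_imp_mixed_bound\<close>). If the norm of \<open>v\<close> alone did not control some compact set
  \<open>L\<close>, there would be functions of maximum modulus one on \<open>L\<close> whose norms tend to zero. By the
  mixed bound they are locally bounded, so by Montel's theorem a subsequence converges. The limit
  still has maximum modulus one on \<open>L\<close> although its norm is zero, which contradicts the
  assumption that the seminorm is a norm (\<open>equal_spaces_imp_controls_compacta\<close>).
\<close>

section \<open>The weighted seminorm and its finiteness space\<close>

lemma bounded_weighted_imp_Hinf:
  assumes "f \<in> holo_space G" "\<And>z. z \<in> G \<Longrightarrow> v z * cmod (f z) \<le> C"
  shows "f \<in> Hinf G v"
proof -
  have "weighted_sup G v f \<le> ennreal C"
    unfolding weighted_sup_def by (intro SUP_least ennreal_leI assms)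
  also have "\<dots> < \<infinity>" by simp
  finally show ?thesis using assms(1) by (simp add: Hinf_def)
qed

lemma Hinf_imp_holo: "f \<in> Hinf G v \<Longrightarrow> f \<in> holo_space G"
  by (simp add: Hinf_def)

lemma Hinf_imp_holomorphic: "f \<in> Hinf G v \<Longrightarrow> f holomorphic_on G"
  by (simp add: Hinf_def holo_space_def)

lemma wnorm_nonneg [simp]: "0 \<le> wnorm G v f"
  by (simp add: wnorm_def)

lemma wnorm_upper:
  assumes "weight_on G v" "f \<in> Hinf G v" "z \<in> G"
  shows "v z * cmod (f z) \<le> wnorm G v f"
proof -
  have fin: "weighted_sup G v f < top" using assms by (simp add: Hinf_def)
  have "ennreal (v z * cmod (f z)) \<le> weighted_sup G v f"
    unfolding weighted_sup_def using assms by (intro SUP_upper)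
  also have "\<dots> = ennreal (wnorm G v f)" using fin by (simp add: wnorm_def)
  finally show ?thesis by simp
qed

lemma wnorm_least:
  assumes "0 \<le> C" "\<And>z. z \<in> G \<Longrightarrow> v z * cmod (f z) \<le> C"
  shows "wnorm G v f \<le> C"
  unfolding wnorm_def weighted_sup_def
  by (intro enn2real_leI assms SUP_least ennreal_leI)

lemma holo_space_zero: "(\<lambda>z. 0) \<in> holo_space G"
  by (simp add: holo_space_def)

lemma holo_space_scale: "f \<in> holo_space G \<Longrightarrow> (\<lambda>z. c * f z) \<in> holo_space G"
  by (auto simp: holo_space_def intro!: holomorphic_intros)

lemma holo_space_add:
  "f \<in> holo_space G \<Longrightarrow> g \<in> holo_space G \<Longrightarrow> (\<lambda>z. f z + g z) \<in> holo_space G"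
  by (auto simp: holo_space_def intro!: holomorphic_intros)

lemma Hinf_zero: "(\<lambda>z. 0) \<in> Hinf G v"
  by (rule bounded_weighted_imp_Hinf[of _ _ _ 0]) (auto simp: holo_space_zero)

lemma
  assumes "weight_on G v" "f \<in> Hinf G v"
  shows Hinf_scale: "(\<lambda>z. c * f z) \<in> Hinf G v"
    and wnorm_scale_le: "wnorm G v (\<lambda>z. c * f z) \<le> cmod c * wnorm G v f"
proof -
  have le: "v z * cmod (c * f z) \<le> cmod c * wnorm G v f" if "z \<in> G" for z
    using mult_left_mono[OF wnorm_upper[OF assms that], of "cmod c"]
    by (simp add: norm_mult mult_ac)
  show "(\<lambda>z. c * f z) \<in> Hinf G v"
    using le by (intro bounded_weighted_imp_Hinf holo_space_scale Hinf_imp_holo[OF assms(2)])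
  show "wnorm G v (\<lambda>z. c * f z) \<le> cmod c * wnorm G v f"
    using le by (intro wnorm_least) auto
qed

lemma
  assumes "weight_on G v" "f \<in> Hinf G v" "g \<in> Hinf G v"
  shows Hinf_add: "(\<lambda>z. f z + g z) \<in> Hinf G v"
    and wnorm_add_le: "wnorm G v (\<lambda>z. f z + g z) \<le> wnorm G v f + wnorm G v g"
proof -
  have le: "v z * cmod (f z + g z) \<le> wnorm G v f + wnorm G v g" if "z \<in> G" for z
  proof -
    have "v z * cmod (f z + g z) \<le> v z * (cmod (f z) + cmod (g z))"
      using assms(1) that by (intro mult_left_mono norm_triangle_ineq) (auto simp: weight_on_def)
    also have "\<dots> \<le> wnorm G v f + wnorm G v g"
      using wnorm_upper[OF assms(1,2) that] wnorm_upper[OF assms(1,3) that]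
      by (simp add: distrib_left)
    finally show ?thesis .
  qed
  show "(\<lambda>z. f z + g z) \<in> Hinf G v"
    using le by (intro bounded_weighted_imp_Hinf holo_space_add Hinf_imp_holo[OF assms(2)]
        Hinf_imp_holo[OF assms(3)])
  show "wnorm G v (\<lambda>z. f z + g z) \<le> wnorm G v f + wnorm G v g"
    using le by (intro wnorm_least) (auto simp: add_nonneg_nonneg)
qed

lemma wnorm_diff_le:
  assumes "weight_on G v" "f \<in> Hinf G v" "g \<in> Hinf G v"
  shows "wnorm G v (\<lambda>z. f z - g z) \<le> wnorm G v f + wnorm G v g"
  using wnorm_add_le[OF assms(1,2) Hinf_scale[OF assms(1,3), of "-1"]]
    wnorm_scale_le[OF assms(1,3), of "-1"] by simp

text \<open>A function that vanishes wherever the weight is positive belongs to the space, with norm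
  zero. This is how limits that are only known through the weight get identified.\<close>

lemma Hinf_normed_eq_zero:
  assumes "Hinf_normed G v" "f \<in> holo_space G" "\<And>z. z \<in> G \<Longrightarrow> v z * cmod (f z) \<le> 0"
  shows "f = (\<lambda>z. 0)"
proof -
  have "f \<in> Hinf G v" using assms(2,3) by (rule bounded_weighted_imp_Hinf)
  moreover have "wnorm G v f = 0"
    using wnorm_least[of 0 G v f] assms(3) by (simp add: antisym)
  ultimately show ?thesis
    using assms(1) by (simp add: Hinf_normed_def is_norm_on_def)
qed

section \<open>Exhaustions and locally uniform limits\<close>

text \<open>The second condition turns bounds on the sets \<open>K n\<close> into locally uniform ones. Subsequences
  inherit both conditions, which the gliding hump argument uses.\<close>

definition exhaustion :: "complex set \<Rightarrow> (nat \<Rightarrow> complex set) \<Rightarrow> bool" where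
  "exhaustion G K \<longleftrightarrow> (\<forall>n. compact (K n) \<and> K n \<subseteq> G \<and> K n \<subseteq> K (Suc n)) \<and>
     (\<forall>L. compact L \<and> L \<subseteq> G \<longrightarrow> (\<exists>n. L \<subseteq> K n))"

lemma exhaustion_exists:
  assumes "open G"
  shows "\<exists>K. exhaustion G K"
proof -
  obtain K where K: "\<And>n. compact (K n)" "\<And>n. K n \<subseteq> G" "\<And>n. K n \<subseteq> interior (K (Suc n))"
      "\<And>L. \<lbrakk>compact L; L \<subseteq> G\<rbrakk> \<Longrightarrow> \<exists>N::nat. \<forall>n\<ge>N. L \<subseteq> K n"
    using open_Union_compact_subsets[OF assms] by metis
  have "exhaustion G K"
    unfolding exhaustion_def using K interior_subset by (meson order.refl order.trans)
  then show ?thesis by blast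
qed

lemma exhaustion_mono:
  assumes "exhaustion G K" "m \<le> n"
  shows "K m \<subseteq> K n"
  using assms lift_Suc_mono_le[of K] by (simp add: exhaustion_def)

lemma exhaustion_subseq:
  assumes "exhaustion G K" "strict_mono m"
  shows "exhaustion G (\<lambda>n. K (m n))"
  unfolding exhaustion_def
proof (intro conjI allI impI)
  fix n
  show "compact (K (m n))" "K (m n) \<subseteq> G"
    using assms(1) by (auto simp: exhaustion_def)
  show "K (m n) \<subseteq> K (m (Suc n))"
    using exhaustion_mono[OF assms(1)] assms(2) by (simp add: strict_mono_less_eq)
next
  fix L assume "compact L \<and> L \<subseteq> G"
  then obtain n where "L \<subseteq> K n" using assms(1) by (auto simp: exhaustion_def)
  then show "\<exists>n. L \<subseteq> K (m n)"
    using exhaustion_mono[OF assms(1) strict_mono_imp_increasing[OF assms(2)]] by blast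
qed

lemma holo_space_locally_uniform_Cauchy_limit:
  assumes "open G" "\<And>n. s n \<in> holo_space G"
    and "\<And>L. \<lbrakk>compact L; L \<subseteq> G\<rbrakk> \<Longrightarrow> uniformly_Cauchy_on L s"
  shows "\<exists>g\<in>holo_space G. \<forall>z. (\<lambda>n. s n z) \<longlonglongrightarrow> g z"
proof -
  define g where "g z = lim (\<lambda>n. s n z)" for z
  have ul: "uniform_limit L s g sequentially" if "compact L" "L \<subseteq> G" for L
    using Cauchy_uniformly_convergent[OF assms(3)[OF that]]
    unfolding uniformly_convergent_uniform_limit_iff g_def .
  have "g holomorphic_on G"
  proof (rule holomorphic_uniform_sequence[OF assms(1)])
    show "s n holomorphic_on G" for n using assms(2) by (simp add: holo_space_def)
    fix x assume "x \<in> G"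
    then obtain d where "d > 0" "cball x d \<subseteq> G" using assms(1) open_contains_cball by blast
    then show "\<exists>d>0. cball x d \<subseteq> G \<and> uniform_limit (cball x d) s g sequentially"
      using ul by auto
  qed
  moreover have off: "s n z = 0" if "z \<notin> G" for n z
    using assms(2) that by (simp add: holo_space_def)
  ultimately have "g \<in> holo_space G" by (simp add: holo_space_def g_def)
  moreover have "(\<lambda>n. s n z) \<longlonglongrightarrow> g z" for z
  proof (cases "z \<in> G")
    case True
    then show ?thesis using tendsto_uniform_limitI[OF ul[of "{z}"], of z] by simp
  qed (simp add: off g_def)
  ultimately show ?thesis by blast
qed

text \<open>The increments are controlled only on the \<open>n\<close>-th set of the exhaustion. Since the sets
  increase, on a fixed compact set all but finitely many increments are dominated by a geometric
  series. This is the summation step of both the closed graph and the gliding hump argument.\<close>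

lemma holo_space_geometric_limit:
  assumes "open G" "exhaustion G K" "\<And>n. s n \<in> holo_space G"
    and step: "\<And>n z. z \<in> K n \<Longrightarrow> cmod (s (Suc n) z - s n z) \<le> (1/2)^n"
  shows "\<exists>g\<in>holo_space G. (\<forall>z. (\<lambda>n. s n z) \<longlonglongrightarrow> g z) \<and>
           (\<forall>k. \<forall>z\<in>K k. cmod (g z - s k z) \<le> 2 * (1/2)^k)"
proof -
  have tel: "cmod (s (k + j) z - s k z) \<le> 2 * (1/2)^k - 2 * (1/2)^(k+j)" if "z \<in> K k" for k j z
  proof (induction j)
    case (Suc j)
    have "z \<in> K (k + j)" using that exhaustion_mono[OF assms(2), of k "k + j"] by auto
    from step[OF this] have "cmod (s (Suc (k + j)) z - s (k + j) z) \<le> (1/2)^(k+j)" .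
    moreover have "cmod (s (k + Suc j) z - s k z)
        \<le> cmod (s (Suc (k + j)) z - s (k + j) z) + cmod (s (k + j) z - s k z)"
      using norm_triangle_ineq[of "s (Suc (k + j)) z - s (k + j) z" "s (k + j) z - s k z"] by simp
    ultimately show ?case using Suc by simp
  qed simp
  have le: "cmod (s n z - s k z) \<le> 2 * (1/2)^k" if "z \<in> K k" "k \<le> n" for k n z
  proof -
    obtain j where "n = k + j" using le_Suc_ex[OF \<open>k \<le> n\<close>] by blast
    moreover have "2 * (1/2)^k - 2 * (1/2)^(k+j) \<le> 2 * (1/2::real)^k" by simp
    ultimately show ?thesis using tel[OF \<open>z \<in> K k\<close>, of j] by (metis order_trans)
  qed
  have "uniformly_Cauchy_on L s" if L: "compact L" "L \<subseteq> G" for L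
  proof (rule uniformly_Cauchy_onI')
    fix e :: real assume "e > 0"
    obtain N where N: "L \<subseteq> K N" using L assms(2) by (auto simp: exhaustion_def)
    have "(\<lambda>k. 2 * (1/2::real)^k) \<longlonglongrightarrow> 0" by real_asymp
    then obtain M where M: "\<And>k. k \<ge> M \<Longrightarrow> 2 * (1/2::real)^k < e"
      using order_tendstoD(2)[OF _ \<open>e > 0\<close>] by (metis eventually_sequentially)
    show "\<exists>M. \<forall>x\<in>L. \<forall>m\<ge>M. \<forall>n>m. dist (s m x) (s n x) < e"
    proof (intro exI ballI allI impI)
      fix x m n assume "x \<in> L" "m \<ge> max M N" "n > m"
      then have "x \<in> K m" using N exhaustion_mono[OF assms(2), of N m] by auto
      then show "dist (s m x) (s n x) < e"
        using le[of x m n] M[of m] \<open>m \<ge> max M N\<close> \<open>n > m\<close>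
        by (simp add: dist_norm norm_minus_commute)
    qed
  qed
  from holo_space_locally_uniform_Cauchy_limit[OF assms(1,3) this] obtain g
    where g: "g \<in> holo_space G" "\<And>z. (\<lambda>n. s n z) \<longlonglongrightarrow> g z" by blast
  have "cmod (g z - s k z) \<le> 2 * (1/2)^k" if "z \<in> K k" for z k
  proof (rule tendsto_upperbound)
    show "(\<lambda>n. cmod (s n z - s k z)) \<longlonglongrightarrow> cmod (g z - s k z)"
      by (intro tendsto_intros g)
    show "\<forall>\<^sub>F n in sequentially. cmod (s n z - s k z) \<le> 2 * (1/2)^k"
      using le[OF that] by (auto simp: eventually_sequentially)
  qed simp
  with g show ?thesis by blast
qed

section \<open>Norms that control functions on compact sets\<close>

definition controls_compacta :: "complex set \<Rightarrow> (complex \<Rightarrow> real) \<Rightarrow> bool" where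
  "controls_compacta G v \<longleftrightarrow> (\<forall>K. compact K \<and> K \<subseteq> G \<longrightarrow>
     (\<exists>C. \<forall>f\<in>Hinf G v. \<forall>z\<in>K. cmod (f z) \<le> C * wnorm G v f))"

lemma controls_compactaE:
  assumes "controls_compacta G v" "compact K" "K \<subseteq> G"
  obtains C where "\<And>f z. \<lbrakk>f \<in> Hinf G v; z \<in> K\<rbrakk> \<Longrightarrow> cmod (f z) \<le> C * wnorm G v f"
proof -
  have "\<exists>C. \<forall>f\<in>Hinf G v. \<forall>z\<in>K. cmod (f z) \<le> C * wnorm G v f"
    using assms by (simp add: controls_compacta_def)
  then show thesis using that by metis
qed

text \<open>Homogeneity. The normalisation divides by the norm of \<open>f\<close>, so an \<open>f\<close> of norm zero has to be
  zero already.\<close>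

lemma small_ball_bound_imp_control:
  assumes "weight_on G v" "Hinf_normed G v" "\<delta> > 0"
    and bd: "\<And>f z. \<lbrakk>f \<in> Hinf G v; wnorm G v f < \<delta>; z \<in> K\<rbrakk> \<Longrightarrow> cmod (f z) \<le> C"
    and f: "f \<in> Hinf G v" and z: "z \<in> K"
  shows "cmod (f z) \<le> 2 * C / \<delta> * wnorm G v f"
proof (cases "wnorm G v f = 0")
  case True
  then have "f = (\<lambda>z. 0)" using assms(2) f by (simp add: Hinf_normed_def is_norm_on_def)
  then show ?thesis using True by simp
next
  case False
  define N where "N = wnorm G v f"
  have N: "N > 0" using False by (simp add: N_def order_less_le)
  \<comment> \<open>The factor 2 makes the rescaled norm strictly smaller than \<open>\<delta>\<close>.\<close>
  define c where "c = complex_of_real (\<delta> / (2 * N))"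
  have c: "cmod c = \<delta> / (2 * N)" using N \<open>\<delta> > 0\<close> by (simp only: c_def norm_of_real) simp
  have "wnorm G v (\<lambda>z. c * f z) \<le> \<delta> / 2"
    using wnorm_scale_le[OF assms(1) f, of c] c N by (simp add: N_def)
  then have "wnorm G v (\<lambda>z. c * f z) < \<delta>" using \<open>\<delta> > 0\<close> by simp
  from bd[OF Hinf_scale[OF assms(1) f] this z] have "\<delta> / (2 * N) * cmod (f z) \<le> C"
    by (simp add: norm_mult c)
  then show ?thesis using N \<open>\<delta> > 0\<close> by (simp add: N_def[symmetric] field_simps)
qed

lemma controls_compacta_imp_complete:
  assumes "open G" "weight_on G v" "Hinf_normed G v" "controls_compacta G v"
  shows "Hinf_complete G v"
proof -
  interpret Metric_space "Hinf G v" "wdist G v" by (rule Hinf_metric_space[OF assms(2,3)])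
  have "\<exists>g. limitin mtopology \<sigma> g sequentially" if "MCauchy \<sigma>" for \<sigma>
  proof -
    have \<sigma>: "\<sigma> n \<in> Hinf G v" for n using that unfolding MCauchy_def by blast
    have cau: "\<exists>N. \<forall>n n'. N \<le> n \<longrightarrow> N \<le> n' \<longrightarrow> wnorm G v (\<lambda>z. \<sigma> n z - \<sigma> n' z) < e"
      if "e > 0" for e using \<open>MCauchy \<sigma>\<close> that unfolding MCauchy_def wdist_def by blast
    have "uniformly_Cauchy_on L \<sigma>" if L: "compact L" "L \<subseteq> G" for L
    proof (rule uniformly_Cauchy_onI')
      fix e :: real assume "e > 0"
      obtain C where C: "\<And>f z. \<lbrakk>f \<in> Hinf G v; z \<in> L\<rbrakk> \<Longrightarrow> cmod (f z) \<le> C * wnorm G v f"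
        using controls_compactaE[OF assms(4) L] by metis
      have "e / (\<bar>C\<bar> + 1) > 0" using \<open>e > 0\<close> by (simp add: add_nonneg_pos)
      from cau[OF this] obtain N where N: "\<And>n n'. N \<le> n \<Longrightarrow> N \<le> n' \<Longrightarrow>
        wnorm G v (\<lambda>z. \<sigma> n z - \<sigma> n' z) < e / (\<bar>C\<bar> + 1)" by blast
      show "\<exists>M. \<forall>x\<in>L. \<forall>m\<ge>M. \<forall>n>m. dist (\<sigma> m x) (\<sigma> n x) < e"
      proof (intro exI ballI allI impI)
        fix x m n assume x: "x \<in> L" and mn: "m \<ge> N" "m < n"
        let ?d = "wnorm G v (\<lambda>z. \<sigma> m z - \<sigma> n z)"
        have "dist (\<sigma> m x) (\<sigma> n x) \<le> C * ?d"
          using C[OF Hinf_diff[OF assms(2) \<sigma> \<sigma>] x] by (simp add: dist_norm)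
        also have "\<dots> \<le> (\<bar>C\<bar> + 1) * ?d" by (intro mult_right_mono) auto
        also have "\<dots> < e" using N[of m n] mn by (simp add: pos_less_divide_eq mult.commute)
        finally show "dist (\<sigma> m x) (\<sigma> n x) < e" .
      qed
    qed
    from holo_space_locally_uniform_Cauchy_limit[OF assms(1) Hinf_imp_holo[OF \<sigma>] this]
    obtain g where g: "g \<in> holo_space G" "\<And>z. (\<lambda>n. \<sigma> n z) \<longlonglongrightarrow> g z" by blast
    have lim: "\<exists>N. \<forall>n\<ge>N. \<forall>z\<in>G. v z * cmod (\<sigma> n z - g z) \<le> e" if "e > 0" for e
    proof -
      obtain N where N: "\<And>n n'. N \<le> n \<Longrightarrow> N \<le> n' \<Longrightarrow> wnorm G v (\<lambda>z. \<sigma> n z - \<sigma> n' z) < e"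
        using cau[OF \<open>e > 0\<close>] by blast
      have "v z * cmod (\<sigma> n z - g z) \<le> e" if "n \<ge> N" "z \<in> G" for n z
      proof (rule tendsto_upperbound)
        show "(\<lambda>k. v z * cmod (\<sigma> n z - \<sigma> k z)) \<longlonglongrightarrow> v z * cmod (\<sigma> n z - g z)"
          by (intro tendsto_intros g)
        show "\<forall>\<^sub>F k in sequentially. v z * cmod (\<sigma> n z - \<sigma> k z) \<le> e"
          unfolding eventually_sequentially
        proof (intro exI allI impI)
          fix k assume "k \<ge> N"
          then show "v z * cmod (\<sigma> n z - \<sigma> k z) \<le> e"
            using N[OF \<open>n \<ge> N\<close>] wnorm_upper[OF assms(2) Hinf_diff[OF assms(2) \<sigma> \<sigma>] \<open>z \<in> G\<close>]
            by (meson less_imp_le order_trans)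
        qed
      qed simp
      then show ?thesis by blast
    qed
    obtain N where N: "\<And>z. z \<in> G \<Longrightarrow> v z * cmod (\<sigma> N z - g z) \<le> 1"
      using lim[of 1] by auto
    have "(\<lambda>z. \<sigma> N z - g z) \<in> holo_space G"
      using holo_space_add[OF Hinf_imp_holo[OF \<sigma>] holo_space_scale[OF g(1), of "-1"], of N]
      by simp
    then have "(\<lambda>z. \<sigma> N z - g z) \<in> Hinf G v" using N by (rule bounded_weighted_imp_Hinf)
    from Hinf_diff[OF assms(2) \<sigma> this, of N] have gH: "g \<in> Hinf G v" by simp
    have "limitin mtopology \<sigma> g sequentially"
      unfolding limit_metric_sequentially
    proof (intro conjI allI impI gH)
      fix e :: real assume "e > 0"
      then obtain N where "\<forall>n\<ge>N. \<forall>z\<in>G. v z * cmod (\<sigma> n z - g z) \<le> e/2"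
        using lim[of "e/2"] by auto
      then have "wdist G v (\<sigma> n) g < e" if "n \<ge> N" for n
        using wnorm_least[of "e/2" G v "\<lambda>z. \<sigma> n z - g z"] \<open>e > 0\<close> that by (force simp: wdist_def)
      then show "\<exists>N. \<forall>n\<ge>N. \<sigma> n \<in> Hinf G v \<and> wdist G v (\<sigma> n) g < e" using \<sigma> by blast
    qed
    then show ?thesis by blast
  qed
  then show ?thesis by (simp add: Hinf_complete_def mcomplete_def)
qed


text \<open>Every member of the space is bounded on \<open>K\<close>, so the sets of members bounded by \<open>m\<close> on \<open>K\<close>
  cover the space. By Baire the closure of one of them contains a ball. Since these sets are
  symmetric and convex, differences move the ball to the origin. The closure cannot be dropped
  here: such a set need not be closed for the weighted norm.\<close>

lemma complete_imp_approximation: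
  assumes "weight_on G v" "Hinf_normed G v" "Hinf_complete G v" "compact K" "K \<subseteq> G"
  shows "\<exists>\<epsilon>>0. \<forall>f\<in>Hinf G v. wnorm G v f < \<epsilon> \<longrightarrow>
    (\<forall>\<eta>>0. \<exists>g\<in>Hinf G v. (\<forall>z\<in>K. cmod (g z) \<le> 1) \<and> wnorm G v (\<lambda>z. f z - g z) < \<eta>)"
proof -
  interpret Metric_space "Hinf G v" "wdist G v" by (rule Hinf_metric_space[OF assms(1,2)])
  define A where "A m = {f \<in> Hinf G v. \<forall>z\<in>K. cmod (f z) \<le> real m}" for m :: nat
  have AM: "A m \<subseteq> Hinf G v" for m by (auto simp: A_def)
  have absorb: "\<exists>m. f \<in> A m" if f: "f \<in> Hinf G v" for f
  proof -
    have "continuous_on K f"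
      using Hinf_imp_holomorphic[OF f] assms(5)
      by (meson continuous_on_subset holomorphic_on_imp_continuous_on)
    then have "bounded (f ` K)"
      using assms(4) compact_continuous_image compact_imp_bounded by blast
    then obtain B where "\<And>z. z \<in> K \<Longrightarrow> cmod (f z) \<le> B" by (auto simp: bounded_iff)
    moreover obtain m where "B \<le> real m" using real_arch_simple by blast
    ultimately show ?thesis using f unfolding A_def by (blast intro: order_trans)
  qed
  have cl: "A m \<subseteq> mtopology closure_of (A m)" for m
    by (rule closure_of_subset) (simp add: AM)
  have clM: "mtopology closure_of (A m) \<subseteq> Hinf G v" for m
    using closure_of_subset_topspace[of mtopology] by simp
  have cover: "(\<Union>m. mtopology closure_of (A m)) = Hinf G v"
  proof (rule subset_antisym)
    show "Hinf G v \<subseteq> (\<Union>m. mtopology closure_of (A m))"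
      using absorb cl by blast
  qed (use clM in blast)
  have "\<exists>m. mtopology interior_of (mtopology closure_of (A m)) \<noteq> {}"
  proof (rule ccontr)
    assume neg: "\<nexists>m. mtopology interior_of (mtopology closure_of (A m)) \<noteq> {}"
    have "mtopology interior_of \<Union>(range (\<lambda>m. mtopology closure_of (A m))) = {}"
    proof (rule metric_Baire_category_alt)
      show "mcomplete" using assms(3) by (simp add: Hinf_complete_def)
      fix T assume "T \<in> range (\<lambda>m. mtopology closure_of (A m))"
      then obtain m where "T = mtopology closure_of (A m)" by blast
      then show "closedin mtopology T \<and> mtopology interior_of T = {}" using neg by simp
    qed simp
    then have "mtopology interior_of (Hinf G v) = {}" by (simp only: cover)
    moreover have "mtopology interior_of (Hinf G v) = Hinf G v"
      using interior_of_topspace[of mtopology] by (simp only: topspace_mtopology)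
    ultimately show False
      using Hinf_zero[of G v] by blast
  qed
  then obtain m f0 where "f0 \<in> mtopology interior_of (mtopology closure_of (A m))" by blast
  then obtain r where f0: "f0 \<in> Hinf G v" and "r > 0"
    and ball: "mball f0 r \<subseteq> mtopology closure_of (A m)"
    unfolding in_interior_of_mball by blast
  define N where "N = 2 * real m + 1"
  have N: "N > 0" by (simp add: N_def)
  have near: "\<exists>a\<in>A m. wnorm G v (\<lambda>z. f0 z + h z - a z) < \<eta>"
    if h: "h \<in> Hinf G v" "wnorm G v h < r" and "\<eta> > 0" for h \<eta>
  proof -
    have "(\<lambda>z. f0 z + h z) \<in> mball f0 r"
      using wnorm_scale_le[OF assms(1) h(1), of "-1"] h Hinf_add[OF assms(1) f0 h(1)] f0
      by (simp add: wdist_def)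
    with ball have "(\<lambda>z. f0 z + h z) \<in> mtopology closure_of (A m)" by blast
    then obtain a where "a \<in> A m" "a \<in> mball (\<lambda>z. f0 z + h z) \<eta>"
      using \<open>\<eta> > 0\<close> unfolding metric_closure_of by blast
    then show ?thesis by (intro bexI[of _ a]) (simp_all add: wdist_def)
  qed
  show ?thesis
  proof (intro exI[of _ "r / N"] conjI ballI impI allI)
    show "r / N > 0" using N \<open>r > 0\<close> by simp
    fix f and \<eta> :: real
    assume f: "f \<in> Hinf G v" "wnorm G v f < r / N" and "\<eta> > 0"
    let ?c = "complex_of_real N" and ?i = "complex_of_real (1 / N)"
    have cn: "cmod ?c = N" "cmod ?i = 1 / N" using N by (simp_all only: norm_of_real) auto
    have "wnorm G v (\<lambda>z. ?c * f z) < r"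
      using wnorm_scale_le[OF assms(1) f(1), of ?c] f(2) N cn by (simp add: field_simps)
    from near[OF Hinf_scale[OF assms(1) f(1)] this, of "N * \<eta> / 2"] obtain a
      where a: "a \<in> A m" "wnorm G v (\<lambda>z. f0 z + ?c * f z - a z) < N * \<eta> / 2"
      using N \<open>\<eta> > 0\<close> by auto
    have "wnorm G v (\<lambda>z. 0) < r"
      using wnorm_least[of 0 G v "\<lambda>z. 0"] \<open>r > 0\<close> by simp
    from near[OF Hinf_zero this, of "N * \<eta> / 2"] obtain b
      where b: "b \<in> A m" "wnorm G v (\<lambda>z. f0 z - b z) < N * \<eta> / 2"
      using N \<open>\<eta> > 0\<close> by auto
    have aH: "a \<in> Hinf G v" and bH: "b \<in> Hinf G v" using a b AM by auto
    let ?g = "\<lambda>z. ?i * (a z - b z)"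
    have gH: "?g \<in> Hinf G v" by (intro Hinf_scale Hinf_diff assms(1) aH bH)
    have g1: "cmod (?g z) \<le> 1" if "z \<in> K" for z
    proof -
      have "cmod (a z - b z) \<le> N"
        using norm_triangle_ineq4[of "a z" "b z"] a(1) b(1) that by (force simp: A_def N_def)
      then show ?thesis using N cn by (simp only: norm_mult) (simp add: field_simps)
    qed
    let ?u = "\<lambda>z. f0 z + ?c * f z - a z" and ?w = "\<lambda>z. f0 z - b z"
    have u: "?u \<in> Hinf G v" and w: "?w \<in> Hinf G v"
      by (intro Hinf_diff Hinf_add Hinf_scale assms(1) aH bH f0 f(1))+
    have eq: "(\<lambda>z. f z - ?g z) = (\<lambda>z. ?i * (?u z - ?w z))"
      using N by (auto simp: fun_eq_iff field_simps)
    have "wnorm G v (\<lambda>z. f z - ?g z) \<le> 1 / N * wnorm G v (\<lambda>z. ?u z - ?w z)"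
      unfolding eq using wnorm_scale_le[OF assms(1) Hinf_diff[OF assms(1) u w], of ?i]
      by (simp only: cn)
    also have "\<dots> < 1 / N * (N * \<eta> / 2 + N * \<eta> / 2)"
      using wnorm_diff_le[OF assms(1) u w] a(2) b(2) N
      by (intro mult_strict_left_mono) auto
    also have "\<dots> = \<eta>" using N by simp
    finally have "wnorm G v (\<lambda>z. f z - ?g z) < \<eta>" .
    with gH g1 show "\<exists>g\<in>Hinf G v. (\<forall>z\<in>K. cmod (g z) \<le> 1) \<and> wnorm G v (\<lambda>z. f z - g z) < \<eta>"
      by (intro bexI[of _ ?g]) auto
  qed
qed

text \<open>Iterating the approximation writes a function \<open>f\<close> of small norm as a series that converges to
  \<open>f\<close> in the weighted norm and whose \<open>n\<close>-th term is at most \<open>(1/2)^n\<close> on \<open>K n\<close>. The series also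
  converges locally uniformly, to a function \<open>g\<close> that agrees with \<open>f\<close> where the weight is
  positive. Hence \<open>f = g\<close>, and \<open>g\<close> is bounded by \<open>2\<close> on \<open>K 0\<close>. It would not do to
  iterate on a single compact set: the limit would then be known on that set only, and the weight
  may vanish there.\<close>

lemma complete_imp_controls_compacta:
  assumes "open G" "weight_on G v" "Hinf_normed G v" "Hinf_complete G v"
  shows "controls_compacta G v"
  unfolding controls_compacta_def
proof (intro allI impI)
  fix L assume L: "compact L \<and> L \<subseteq> G"
  obtain K' where K': "exhaustion G K'" using exhaustion_exists[OF assms(1)] by blast
  obtain i where i: "L \<subseteq> K' i" using K' L by (auto simp: exhaustion_def)
  define K where "K n = K' (i + n)" for n
  have K: "exhaustion G K"
    using exhaustion_subseq[OF K', of "\<lambda>n. i + n"] by (simp add: K_def[abs_def] strict_mono_def)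
  define R where "R n \<epsilon> \<longleftrightarrow> (\<forall>f\<in>Hinf G v. wnorm G v f < \<epsilon> \<longrightarrow> (\<forall>\<eta>>0. \<exists>g\<in>Hinf G v.
      (\<forall>z\<in>K n. cmod (g z) \<le> 1) \<and> wnorm G v (\<lambda>z. f z - g z) < \<eta>))" for n \<epsilon>
  have "\<exists>\<epsilon>>0. R n \<epsilon>" for n
    unfolding R_def using K
    by (intro complete_imp_approximation[OF assms(2-4)]) (auto simp: exhaustion_def)
  then obtain \<epsilon> where \<epsilon>: "\<And>n. \<epsilon> n > 0" and R: "\<And>n. R n (\<epsilon> n)" by metis
  have approx: "\<exists>g\<in>Hinf G v. (\<forall>z\<in>K n. cmod (g z) \<le> 1) \<and> wnorm G v (\<lambda>z. f z - g z) < \<eta>"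
    if "f \<in> Hinf G v" "wnorm G v f < \<epsilon> n" "\<eta> > 0" for n f \<eta>
    using R[of n, unfolded R_def, rule_format, OF that] .
  have bd: "cmod (f z) \<le> 2" if f: "f \<in> Hinf G v" "wnorm G v f < min 1 (\<epsilon> 0)" and z: "z \<in> L" for f z
  proof -
    \<comment> \<open>\<open>s\<close> is the \<open>n\<close>-th partial sum. The remainder times \<open>2^n\<close> has norm below \<open>\<epsilon> n\<close>, so
      that it can be approximated again; the cap \<open>1\<close> makes the remainders tend to zero.\<close>
    let ?P = "\<lambda>n s. s \<in> Hinf G v \<and> (n = 0 \<longrightarrow> s = (\<lambda>z. 0)) \<and>
      wnorm G v (\<lambda>z. f z - s z) < (1/2)^n * min 1 (\<epsilon> n)"
    let ?Q = "\<lambda>n s s'. \<forall>z\<in>K n. cmod (s' z - s z) \<le> (1/2)^n"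
    have "\<exists>s. \<forall>n. ?P n (s n) \<and> ?Q n (s n) (s (Suc n))"
    proof (rule dependent_nat_choice)
      show "\<exists>s. ?P 0 s" using f(2) Hinf_zero by auto
      fix s n assume s: "?P n s"
      let ?c = "2 ^ n :: complex" and ?i = "(1/2) ^ n :: complex"
      have cn: "cmod ?c = 2 ^ n" "cmod ?i = (1/2) ^ n" by (simp_all add: norm_power norm_divide)
      let ?r = "\<lambda>z. f z - s z" and ?\<eta> = "1/2 * min 1 (\<epsilon> (Suc n))"
      have r: "?r \<in> Hinf G v" using Hinf_diff[OF assms(2) f(1)] s by blast
      have "wnorm G v (\<lambda>z. ?c * ?r z) < \<epsilon> n"
      proof -
        have "wnorm G v (\<lambda>z. ?c * ?r z) \<le> 2 ^ n * wnorm G v ?r"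
          using wnorm_scale_le[OF assms(2) r, of ?c] by (simp only: cn)
        also have "\<dots> < 2 ^ n * ((1/2)^n * min 1 (\<epsilon> n))"
          using s by (intro mult_strict_left_mono) auto
        also have "\<dots> = min 1 (\<epsilon> n)" by (simp add: power_divide)
        finally show ?thesis by simp
      qed
      from approx[OF Hinf_scale[OF assms(2) r] this, of ?\<eta>] obtain g where g: "g \<in> Hinf G v"
        "\<And>z. z \<in> K n \<Longrightarrow> cmod (g z) \<le> 1" "wnorm G v (\<lambda>z. ?c * ?r z - g z) < ?\<eta>"
        using \<epsilon>[of "Suc n"] by auto
      let ?s = "\<lambda>z. s z + ?i * g z"
      have sH: "s \<in> Hinf G v" using s by blast
      have s1: "?s \<in> Hinf G v" by (intro Hinf_add Hinf_scale assms(2) g sH)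
      have s2: "wnorm G v (\<lambda>z. f z - ?s z) < (1/2)^Suc n * min 1 (\<epsilon> (Suc n))"
      proof -
        have ic: "?i * ?c = 1" by (simp add: power_divide)
        have "f z - ?s z = ?i * (?c * ?r z - g z)" for z
        proof -
          have "?i * (?c * ?r z - g z) = (?i * ?c) * ?r z - ?i * g z"
            by (simp only: right_diff_distrib mult.assoc)
          also have "\<dots> = f z - ?s z" unfolding ic by simp
          finally show ?thesis by simp
        qed
        then have "wnorm G v (\<lambda>z. f z - ?s z) = wnorm G v (\<lambda>z. ?i * (?c * ?r z - g z))"
          by presburger
        also have "\<dots> \<le> (1/2)^n * wnorm G v (\<lambda>z. ?c * ?r z - g z)"
          using wnorm_scale_le[OF assms(2)
            Hinf_diff[OF assms(2) Hinf_scale[OF assms(2) r, of ?c] g(1)], of ?i]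
          unfolding cn(2) .
        also have "\<dots> < (1/2)^n * ?\<eta>" using g(3) by (intro mult_strict_left_mono) auto
        also have "\<dots> = (1/2)^Suc n * min 1 (\<epsilon> (Suc n))" by simp
        finally show ?thesis .
      qed
      have s3: "?Q n s ?s"
      proof
        fix z assume "z \<in> K n"
        have "cmod (?s z - s z) = (1/2)^n * cmod (g z)" by (simp only: add_diff_cancel_left' norm_mult cn)
        also have "\<dots> \<le> (1/2)^n * 1" using g(2)[OF \<open>z \<in> K n\<close>] by (intro mult_left_mono) auto
        finally show "cmod (?s z - s z) \<le> (1/2)^n" by simp
      qed
      show "\<exists>s'. ?P (Suc n) s' \<and> ?Q n s s'"
        by (rule exI[of _ ?s]) (intro conjI impI s1 s2 s3, simp)
    qed
    then obtain s where s: "\<And>n. ?P n (s n)" "\<And>n. ?Q n (s n) (s (Suc n))" by blast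
    have sH: "s n \<in> Hinf G v" for n using s(1)[of n] by blast
    obtain g where g: "g \<in> holo_space G" "\<And>z. (\<lambda>n. s n z) \<longlonglongrightarrow> g z"
        "\<And>k z. z \<in> K k \<Longrightarrow> cmod (g z - s k z) \<le> 2 * (1/2)^k"
      using holo_space_geometric_limit[where s = s, OF assms(1) K Hinf_imp_holo[OF sH]] s(2) by blast
    have "(\<lambda>z. f z - g z) = (\<lambda>z. 0)"
    proof (rule Hinf_normed_eq_zero[OF assms(3)])
      show "(\<lambda>z. f z - g z) \<in> holo_space G"
        using holo_space_add[OF Hinf_imp_holo[OF f(1)] holo_space_scale[OF g(1), of "-1"]] by simp
      fix x assume x: "x \<in> G"
      show "v x * cmod (f x - g x) \<le> 0"
      proof (rule LIMSEQ_le)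
        show "(\<lambda>n. v x * cmod (f x - s n x)) \<longlonglongrightarrow> v x * cmod (f x - g x)"
          by (intro tendsto_intros g)
        show "(\<lambda>n. (1/2::real)^n) \<longlonglongrightarrow> 0" by real_asymp
        have "v x * cmod (f x - s n x) \<le> (1/2)^n" for n
        proof -
          have "v x * cmod (f x - s n x) \<le> wnorm G v (\<lambda>z. f z - s n z)"
            using wnorm_upper[OF assms(2) Hinf_diff[OF assms(2) f(1) sH] x] .
          also have "\<dots> \<le> (1/2)^n * min 1 (\<epsilon> n)" using s(1)[of n] by simp
          also have "\<dots> \<le> (1/2)^n * 1" by (intro mult_left_mono) auto
          finally show ?thesis by simp
        qed
        then show "\<exists>N. \<forall>n\<ge>N. v x * cmod (f x - s n x) \<le> (1/2)^n" by blast
      qed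
    qed
    then have "f z = g z" by (simp add: fun_eq_iff)
    moreover have "s 0 z = 0" using s(1)[of 0] by simp
    moreover have "z \<in> K 0" using z i by (auto simp: K_def)
    ultimately show ?thesis using g(3)[of z 0] by simp
  qed
  have "min 1 (\<epsilon> 0) > 0" using \<epsilon>[of 0] by simp
  from small_ball_bound_imp_control[OF assms(2,3) this, of L 2] bd
  show "\<exists>C. \<forall>f\<in>Hinf G v. \<forall>z\<in>L. cmod (f z) \<le> C * wnorm G v f" by blast
qed

section \<open>The associated weight\<close>

text \<open>Cauchy's estimate on discs of radius \<open>r\<close> bounds the derivative by \<open>B / r\<close>. The Lipschitz
  constant depends on the bound only, so it serves a whole locally bounded family.\<close>

lemma holomorphic_bounded_imp_Lipschitz:
  assumes "f holomorphic_on G" "open G" "cball z0 (2 * r) \<subseteq> G" "r > 0"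
    and B: "\<And>z. z \<in> cball z0 (2 * r) \<Longrightarrow> cmod (f z) \<le> B"
    and xy: "x \<in> ball z0 r" "y \<in> ball z0 r"
  shows "cmod (f x - f y) \<le> B / r * cmod (x - y)"
proof (rule field_differentiable_bound)
  have sub: "cball u r \<subseteq> cball z0 (2 * r)" if "u \<in> ball z0 r" for u
    using that by (subst cball_subset_cball_iff) (auto simp: dist_commute)
  fix u assume u: "u \<in> ball z0 r"
  have "u \<in> G" using sub[OF u] assms(3,4) by force
  then show "(f has_field_derivative deriv f u) (at u within ball z0 r)"
    using holomorphic_derivI[OF assms(1,2)] by (blast intro: has_field_derivative_at_within)
  have holo: "f holomorphic_on cball u r"
    using assms(1,3) sub[OF u] by (meson holomorphic_on_subset order_trans)
  have "cmod ((deriv ^^ 1) f u) \<le> fact 1 * B / r ^ 1"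
  proof (rule Cauchy_inequality)
    show "f holomorphic_on ball u r" by (rule holomorphic_on_subset[OF holo]) auto
    show "continuous_on (cball u r) f" by (rule holomorphic_on_imp_continuous_on[OF holo])
    fix x assume "cmod (u - x) = r"
    then have "x \<in> cball u r" by (simp add: dist_norm)
    then show "cmod (f x) \<le> B" using B sub[OF u] by blast
  qed fact
  then show "cmod (deriv f u) \<le> B / r" by simp
qed (use xy in auto)

text \<open>The weight is the associated weight of \<open>v\<close>. It is at least \<open>v\<close>, because
  \<open>v z * cmod (f z) \<le> 1\<close> throughout the unit ball, and each \<open>f\<close> has the same norm for both
  weights.\<close>

lemma controls_compacta_imp_continuous_weight:
  assumes "open G" "weight_on G v" "bounded (v ` G)" "controls_compacta G v"
  shows "\<exists>w :: complex \<Rightarrow> real. weight_on G w \<and> bounded (w ` G) \<and> continuous_on G w \<and>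
           (\<forall>z\<in>G. 0 < w z) \<and> Hinf G v = Hinf G w"
proof -
  define U where "U = {f \<in> holo_space G. \<forall>z\<in>G. v z * cmod (f z) \<le> 1}"
  define S where "S z = (SUP f\<in>U. cmod (f z))" for z
  define w where "w z = 1 / S z" for z
  obtain M0 where M0: "\<And>z. z \<in> G \<Longrightarrow> \<bar>v z\<bar> \<le> M0" using assms(3) by (auto simp: bounded_iff)
  define M where "M = max 1 M0"
  have M: "M > 0" "\<And>z. z \<in> G \<Longrightarrow> v z \<le> M" using M0 by (force simp: M_def)+
  have UH: "f \<in> Hinf G v" "wnorm G v f \<le> 1" if "f \<in> U" for f
    using that bounded_weighted_imp_Hinf[of f G v 1] wnorm_least[of 1 G v f] by (auto simp: U_def)
  have bdK: "\<exists>B. \<forall>f\<in>U. \<forall>z\<in>K. cmod (f z) \<le> B" if K: "compact K" "K \<subseteq> G" for K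
  proof -
    obtain C where C: "\<And>f z. \<lbrakk>f \<in> Hinf G v; z \<in> K\<rbrakk> \<Longrightarrow> cmod (f z) \<le> C * wnorm G v f"
      using controls_compactaE[OF assms(4) K] by metis
    have "cmod (f z) \<le> \<bar>C\<bar>" if "f \<in> U" "z \<in> K" for f z
    proof -
      have "cmod (f z) \<le> C * wnorm G v f" using C UH(1)[OF that(1)] that(2) by blast
      also have "\<dots> \<le> \<bar>C\<bar> * 1" using UH(2)[OF that(1)] by (intro mult_mono) auto
      finally show ?thesis by simp
    qed
    then show ?thesis by blast
  qed
  have bdd: "bdd_above ((\<lambda>f. cmod (f z)) ` U)" if "z \<in> G" for z
    using bdK[of "{z}"] that by (auto simp: bdd_above_def)
  have upper: "cmod (f z) \<le> S z" if "f \<in> U" "z \<in> G" for f z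
    unfolding S_def using that bdd by (intro cSUP_upper)
  have const: "(\<lambda>z. if z \<in> G then complex_of_real (1 / M) else 0) \<in> U"
  proof -
    have "(\<lambda>z. if z \<in> G then complex_of_real (1 / M) else 0) holomorphic_on G"
      by (rule holomorphic_transform[of "\<lambda>z. complex_of_real (1 / M)"]) auto
    moreover have "cmod (complex_of_real (1 / M)) = 1 / M" using M(1) by (simp only: norm_of_real) auto
    ultimately show ?thesis using M by (simp add: U_def holo_space_def)
  qed
  have Sge: "1 / M \<le> S z" if "z \<in> G" for z
  proof -
    have "cmod (complex_of_real (1 / M)) = 1 / M" using M(1) by (simp only: norm_of_real) auto
    then show ?thesis using upper[OF const that] that by simp
  qed
  have Spos: "S z > 0" if "z \<in> G" for z
    using Sge[OF that] M(1) by (meson divide_pos_pos less_le_trans zero_less_one)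
  have least: "S z \<le> B" if "\<And>f. f \<in> U \<Longrightarrow> cmod (f z) \<le> B" for z B
    unfolding S_def using const that by (intro cSUP_least) auto
  have "isCont S z0" if z0: "z0 \<in> G" for z0
  proof -
    obtain d where d: "d > 0" "cball z0 d \<subseteq> G" using assms(1) z0 open_contains_cball by blast
    define r where "r = d / 2"
    have r: "r > 0" "cball z0 (2 * r) \<subseteq> G" using d by (auto simp: r_def)
    obtain B0 where B0: "\<And>f z. f \<in> U \<Longrightarrow> z \<in> cball z0 (2 * r) \<Longrightarrow> cmod (f z) \<le> B0"
      using bdK[OF compact_cball r(2)] by metis
    have "0 \<le> B0" using B0[OF const, of z0] r(1) by (meson centre_in_cball less_imp_le mult_nonneg_nonneg norm_ge_zero order_trans zero_le_numeral)
    have le: "S x \<le> S y + B0 / r * dist x y" if xy: "x \<in> ball z0 r" "y \<in> ball z0 r" for x y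
    proof (rule least)
      fix f assume f: "f \<in> U"
      have "y \<in> G" using xy(2) r by force
      have "cmod (f x - f y) \<le> B0 / r * cmod (x - y)"
        using Hinf_imp_holomorphic[OF UH(1)[OF f]] assms(1) r B0[OF f] xy
        by (intro holomorphic_bounded_imp_Lipschitz[of f G z0 r B0 x y]) auto
      moreover have "cmod (f x) \<le> cmod (f y) + cmod (f x - f y)"
        using norm_triangle_ineq[of "f y" "f x - f y"] by simp
      ultimately show "cmod (f x) \<le> S y + B0 / r * dist x y"
        using upper[OF f \<open>y \<in> G\<close>] by (simp add: dist_norm)
    qed
    have "(B0 / r)-lipschitz_on (ball z0 r) S"
    proof (rule lipschitz_onI)
      fix x y assume "x \<in> ball z0 r" "y \<in> ball z0 r"
      then show "dist (S x) (S y) \<le> B0 / r * dist x y"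
        using le[of x y] le[of y x] by (simp add: dist_commute dist_real_def abs_le_iff)
    qed (use \<open>0 \<le> B0\<close> r in simp)
    then have "continuous_on (ball z0 r) S" by (rule lipschitz_on_continuous_on)
    then show ?thesis using r(1) by (simp add: continuous_on_eq_continuous_at)
  qed
  then have "continuous_on G S" by (intro continuous_at_imp_continuous_on) blast
  then have "continuous_on G w"
    unfolding w_def using Spos by (intro continuous_intros) force+
  moreover have wpos: "\<forall>z\<in>G. 0 < w z" using Spos by (simp add: w_def)
  moreover have "w z \<le> M" if "z \<in> G" for z
    using Sge[OF that] Spos[OF that] M(1) by (simp add: w_def field_simps)
  then have "bounded (w ` G)"
    using wpos by (auto simp: bounded_iff intro!: exI[of _ M])
  moreover have wt: "weight_on G w" using wpos by (auto simp: weight_on_def)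
  moreover have "Hinf G v = Hinf G w"
  proof (intro subset_antisym subsetI)
    fix f assume f: "f \<in> Hinf G v"
    define N where "N = wnorm G v f + 1"
    have N: "N > 0" unfolding N_def using wnorm_nonneg[of G v f] by linarith
    have cn: "cmod (complex_of_real (1 / N)) = 1 / N" using N by (simp only: norm_of_real) auto
    have "(\<lambda>z. complex_of_real (1 / N) * f z) \<in> U"
      unfolding U_def mem_Collect_eq
    proof (intro conjI ballI holo_space_scale Hinf_imp_holo[OF f])
      fix z assume "z \<in> G"
      from wnorm_upper[OF assms(2) f this] have "v z * cmod (f z) \<le> N" by (simp add: N_def)
      then show "v z * cmod (complex_of_real (1 / N) * f z) \<le> 1"
        using N unfolding norm_mult cn by (simp add: field_simps)
    qed
    from upper[OF this] have "cmod (f z) \<le> N * S z" if "z \<in> G" for z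
      using that N unfolding norm_mult cn by (simp add: field_simps)
    then have "w z * cmod (f z) \<le> N" if "z \<in> G" for z
      using that Spos[OF that] by (simp add: w_def field_simps)
    then show "f \<in> Hinf G w"
      by (rule bounded_weighted_imp_Hinf[OF Hinf_imp_holo[OF f]])
  next
    fix f assume f: "f \<in> Hinf G w"
    have vw: "v z \<le> w z" if z: "z \<in> G" for z
    proof (cases "v z = 0")
      case True
      then show ?thesis using wpos z by force
    next
      case False
      then have vz: "v z > 0" using assms(2) z by (simp add: weight_on_def order_less_le)
      have "S z \<le> 1 / v z"
        using vz z by (intro least) (auto simp: U_def field_simps)
      then show ?thesis using vz Spos[OF z] by (simp add: w_def field_simps)
    qed
    have "v z * cmod (f z) \<le> wnorm G w f" if "z \<in> G" for z
      using mult_right_mono[OF vw[OF that], of "cmod (f z)"] wnorm_upper[OF wt f that] by simp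
    then show "f \<in> Hinf G v"
      by (rule bounded_weighted_imp_Hinf[OF Hinf_imp_holo[OF f]])
  qed
  ultimately show ?thesis by blast
qed

section \<open>Equality of the spaces forces control on compact sets\<close>

text \<open>If the bound fails for all \<open>n\<close> and \<open>C\<close>, summands \<open>(1/2)^n * f\<close> can be chosen one after another
  such that the \<open>n\<close>-th one lifts \<open>w\<close> times the modulus of the partial sum to at least \<open>n\<close> at
  some point, while it is tiny on a compact set that contains all points chosen before. As \<open>w\<close> is
  bounded, the later summands change the values at the earlier points by bounded amounts only, so
  the sum lies in \<open>Hinf G v\<close> but not in \<open>Hinf G w\<close>.\<close>

lemma equal_spaces_imp_mixed_bound:
  assumes "open G" "weight_on G v" "weight_on G w" "bounded (w ` G)"
    and eq: "Hinf G v = Hinf G w" and K: "exhaustion G K"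
  shows "\<exists>n C. \<forall>f\<in>Hinf G v. (\<forall>z\<in>G. v z * cmod (f z) \<le> 1) \<longrightarrow> (\<forall>z\<in>K n. cmod (f z) \<le> 1) \<longrightarrow>
    (\<forall>z\<in>G. w z * cmod (f z) \<le> C)"
proof (rule ccontr)
  assume "\<not> ?thesis"
  then have neg: "\<exists>f\<in>Hinf G v. (\<forall>z\<in>G. v z * cmod (f z) \<le> 1) \<and> (\<forall>z\<in>K n. cmod (f z) \<le> 1) \<and>
    (\<exists>z\<in>G. C < w z * cmod (f z))" for n C by (meson not_le)
  obtain W where W: "\<And>z. z \<in> G \<Longrightarrow> \<bar>w z\<bar> \<le> W" using assms(4) by (auto simp: bounded_iff)
  have KG: "K n \<subseteq> G" for n using K by (simp add: exhaustion_def)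
  \<comment> \<open>A state consists of a partial sum and the index of a set of the exhaustion that contains the
    points chosen so far. The bound \<open>2 - 2 * (1/2)^n\<close> is the sum of the first \<open>n\<close> coefficients.\<close>
  define P where "P n X \<longleftrightarrow> fst X \<in> Hinf G v \<and>
    (\<forall>z\<in>G. v z * cmod (fst X z) \<le> 2 - 2 * (1/2)^n)" for n :: nat and X :: "(complex \<Rightarrow> complex) \<times> nat"
  define Q where "Q n X Y \<longleftrightarrow> snd X < snd Y \<and>
    (\<forall>z\<in>K (snd X). cmod (fst Y z - fst X z) \<le> (1/2)^n) \<and>
    (\<exists>z\<in>K (snd Y). real n \<le> w z * cmod (fst Y z))"
    for n :: nat and X Y :: "(complex \<Rightarrow> complex) \<times> nat"
  have "\<exists>X. \<forall>n. P n (X n) \<and> Q n (X n) (X (Suc n))"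
  proof (rule dependent_nat_choice)
    show "\<exists>X. P 0 X" using Hinf_zero[of G v] by (intro exI[of _ "(\<lambda>z. 0, 0)"]) (simp add: P_def)
    fix X n assume X: "P n X"
    obtain s m where Xe: "X = (s, m)" by fastforce
    have s: "s \<in> Hinf G v" "\<And>z. z \<in> G \<Longrightarrow> v z * cmod (s z) \<le> 2 - 2 * (1/2)^n"
      using X by (auto simp: P_def Xe)
    \<comment> \<open>The lower bound leaves at least \<open>n\<close> after scaling by \<open>(1/2)^n\<close> and losing at most the
      \<open>w\<close>-norm of the previous partial sum.\<close>
    obtain f z0 where f: "f \<in> Hinf G v" "\<And>z. z \<in> G \<Longrightarrow> v z * cmod (f z) \<le> 1"
      "\<And>z. z \<in> K m \<Longrightarrow> cmod (f z) \<le> 1"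
      and z0: "z0 \<in> G" "2 ^ n * (real n + wnorm G w s) < w z0 * cmod (f z0)"
      using neg[of m "2 ^ n * (real n + wnorm G w s)"] by blast
    obtain j where j: "z0 \<in> K j" using K z0(1) unfolding exhaustion_def
      by (metis compact_sing empty_subsetI insert_subset)
    let ?i = "(1/2) ^ n :: complex"
    have cn: "cmod ?i = (1/2) ^ n" by (simp add: norm_power norm_divide)
    let ?s = "\<lambda>z. s z + ?i * f z" and ?m = "max j (Suc m)"
    have tri: "cmod (?s z) \<le> cmod (s z) + (1/2)^n * cmod (f z)"
      "(1/2)^n * cmod (f z) \<le> cmod (?s z) + cmod (s z)" for z
      using norm_triangle_ineq[of "s z" "?i * f z"] norm_triangle_ineq4[of "?s z" "s z"]
      unfolding add_diff_cancel_left' norm_mult cn by auto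
    have "P (Suc n) (?s, ?m)"
      unfolding P_def fst_conv
    proof (intro conjI ballI)
      show "?s \<in> Hinf G v" by (intro Hinf_add Hinf_scale assms(2) s f)
      fix z assume z: "z \<in> G"
      have "v z * cmod (?s z) \<le> v z * (cmod (s z) + (1/2)^n * cmod (f z))"
        using assms(2) z by (intro mult_left_mono tri) (auto simp: weight_on_def)
      also have "\<dots> = v z * cmod (s z) + (1/2)^n * (v z * cmod (f z))" by (simp add: algebra_simps)
      also have "\<dots> \<le> (2 - 2 * (1/2)^n) + (1/2)^n * 1"
        using s(2)[OF z] f(2)[OF z] by (intro add_mono mult_left_mono) auto
      also have "\<dots> = 2 - 2 * (1/2)^Suc n" by simp
      finally show "v z * cmod (?s z) \<le> 2 - 2 * (1/2)^Suc n" .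
    qed
    moreover have "Q n X (?s, ?m)"
      unfolding Q_def fst_conv snd_conv Xe
    proof (intro conjI ballI)
      show "m < ?m" by simp
      fix z assume "z \<in> K m"
      have "cmod (?s z - s z) = (1/2)^n * cmod (f z)"
        by (simp only: add_diff_cancel_left' norm_mult cn)
      also have "\<dots> \<le> (1/2)^n * 1" using f(3)[OF \<open>z \<in> K m\<close>] by (intro mult_left_mono) auto
      finally show "cmod (?s z - s z) \<le> (1/2)^n" by simp
    next
      have wz: "0 \<le> w z0" using assms(3) z0(1) by (simp add: weight_on_def)
      have "real n + wnorm G w s = (1/2)^n * (2 ^ n * (real n + wnorm G w s))"
        by (simp add: power_divide)
      also have "\<dots> \<le> (1/2)^n * (w z0 * cmod (f z0))" using z0(2) by (intro mult_left_mono) auto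
      also have "\<dots> = w z0 * ((1/2)^n * cmod (f z0))" by (simp only: mult.left_commute)
      also have "\<dots> \<le> w z0 * (cmod (?s z0) + cmod (s z0))" by (intro mult_left_mono tri wz)
      also have "\<dots> = w z0 * cmod (?s z0) + w z0 * cmod (s z0)" by (simp only: distrib_left)
      finally have "real n \<le> w z0 * cmod (?s z0)"
        using wnorm_upper[OF assms(3) _ z0(1), of s] s(1) eq by simp
      moreover have "z0 \<in> K ?m" using j exhaustion_mono[OF K, of j ?m] by auto
      ultimately show "\<exists>z\<in>K ?m. real n \<le> w z * cmod (?s z)" by blast
    qed
    ultimately show "\<exists>Y. P (Suc n) Y \<and> Q n X Y" by blast
  qed
  then obtain X where X: "\<And>n. P n (X n)" "\<And>n. Q n (X n) (X (Suc n))" by blast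
  define s where "s n = fst (X n)" for n
  define m where "m n = snd (X n)" for n
  have sH: "s n \<in> Hinf G v" and sv: "z \<in> G \<Longrightarrow> v z * cmod (s n z) \<le> 2 - 2 * (1/2)^n" for n z
    using X(1)[of n] by (auto simp: P_def s_def)
  have "strict_mono m" using X(2) by (simp add: strict_mono_Suc_iff Q_def m_def)
  have step: "cmod (s (Suc n) z - s n z) \<le> (1/2)^n" if "z \<in> K (m n)" for n z
    using X(2)[of n] that by (simp add: Q_def s_def m_def)
  have large: "\<exists>z\<in>K (m (Suc n)). real n \<le> w z * cmod (s (Suc n) z)" for n
    using X(2)[of n] by (simp add: Q_def s_def m_def)
  obtain g where g: "g \<in> holo_space G" "\<And>z. (\<lambda>n. s n z) \<longlonglongrightarrow> g z"
      "\<And>k z. z \<in> K (m k) \<Longrightarrow> cmod (g z - s k z) \<le> 2 * (1/2)^k"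
    using holo_space_geometric_limit[where s = s,
        OF assms(1) exhaustion_subseq[OF K \<open>strict_mono m\<close>] Hinf_imp_holo[OF sH]] step by blast
  have "v z * cmod (g z) \<le> 2" if "z \<in> G" for z
  proof (rule tendsto_upperbound)
    show "(\<lambda>n. v z * cmod (s n z)) \<longlonglongrightarrow> v z * cmod (g z)" by (intro tendsto_intros g)
    have "v z * cmod (s n z) \<le> 2" for n
      using sv[OF that, of n] zero_le_power[of "1/2::real" n] by linarith
    then show "\<forall>\<^sub>F n in sequentially. v z * cmod (s n z) \<le> 2" by simp
  qed simp
  then have gw: "g \<in> Hinf G w" using bounded_weighted_imp_Hinf[OF g(1)] eq by blast
  have "real n \<le> wnorm G w g + W" for n
  proof -
    obtain z where z: "z \<in> K (m (Suc n))" "real n \<le> w z * cmod (s (Suc n) z)" using large by blast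
    have zG: "z \<in> G" using z(1) KG by blast
    have wz: "0 \<le> w z" "w z \<le> W" using assms(3) zG W[OF zG] by (auto simp: weight_on_def)
    have "cmod (g z - s (Suc n) z) \<le> 2 * (1/2)^Suc n" by (rule g(3)[OF z(1)])
    also have "\<dots> \<le> 1" by (simp add: power_le_one)
    finally have "cmod (s (Suc n) z) \<le> cmod (g z) + 1"
      using norm_triangle_ineq4[of "g z" "g z - s (Suc n) z"] by simp
    then have "w z * cmod (s (Suc n) z) \<le> w z * (cmod (g z) + 1)" using wz by (intro mult_left_mono)
    also have "\<dots> = w z * cmod (g z) + w z" by (simp add: distrib_left)
    also have "\<dots> \<le> wnorm G w g + W" using wnorm_upper[OF assms(3) gw zG] wz(2) by simp
    finally show ?thesis using z(2) by simp
  qed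
  then show False using reals_Archimedean2[of "wnorm G w g + W"] by (meson not_le)
qed

text \<open>A compactness argument removes the auxiliary compact set from the mixed bound. The set \<open>L\<close> is
  first enlarged to contain \<open>K n\<close>; functions with maximum modulus one on \<open>L\<close> and small norm then
  satisfy the mixed bound, and positivity and continuity of \<open>w\<close> turn it into local boundedness.\<close>

lemma equal_spaces_imp_controls_compacta:
  assumes "open G" "weight_on G v" "Hinf_normed G v" "weight_on G w" "bounded (w ` G)"
    and "continuous_on G w" and wpos: "\<forall>z\<in>G. 0 < w z" and eq: "Hinf G v = Hinf G w"
  shows "controls_compacta G v"
proof -
  obtain K where K: "exhaustion G K" using exhaustion_exists[OF assms(1)] by blast
  obtain n C where mixed: "\<And>f z. \<lbrakk>f \<in> Hinf G v; \<And>z. z \<in> G \<Longrightarrow> v z * cmod (f z) \<le> 1;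
      \<And>z. z \<in> K n \<Longrightarrow> cmod (f z) \<le> 1; z \<in> G\<rbrakk> \<Longrightarrow> w z * cmod (f z) \<le> C"
    using equal_spaces_imp_mixed_bound[OF assms(1,2,4,5) eq K] by blast
  have "\<exists>\<delta>>0. \<forall>f\<in>Hinf G v. wnorm G v f < \<delta> \<longrightarrow> (\<forall>z\<in>L. cmod (f z) \<le> 1)"
    if L0: "compact L" "L \<subseteq> G" "K n \<subseteq> L" for L
  proof (rule ccontr)
    assume neg: "\<not> ?thesis"
    have "\<exists>h \<zeta>. h \<in> Hinf G v \<and> \<zeta> \<in> L \<and> cmod (h \<zeta>) = 1 \<and> (\<forall>z\<in>L. cmod (h z) \<le> 1) \<and>
        wnorm G v h \<le> 1 / real (Suc j)" for j
    proof -
      have "1 / real (Suc j) > 0" by simp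
      with neg obtain f z0 where f: "f \<in> Hinf G v" "wnorm G v f < 1 / real (Suc j)"
        and z0: "z0 \<in> L" "1 < cmod (f z0)" by (meson not_le)
      have "continuous_on L (\<lambda>z. cmod (f z))"
        by (rule continuous_on_norm[OF holomorphic_on_imp_continuous_on[OF
              holomorphic_on_subset[OF Hinf_imp_holomorphic[OF f(1)] L0(2)]]])
      then obtain \<zeta> where \<zeta>: "\<zeta> \<in> L" "\<And>z. z \<in> L \<Longrightarrow> cmod (f z) \<le> cmod (f \<zeta>)"
        using continuous_attains_sup[OF L0(1)] z0(1) by (metis empty_iff)
      have big: "1 < cmod (f \<zeta>)" using \<zeta>(2)[OF z0(1)] z0(2) by simp
      let ?h = "\<lambda>z. inverse (f \<zeta>) * f z"
      have "wnorm G v ?h \<le> cmod (inverse (f \<zeta>)) * wnorm G v f" by (rule wnorm_scale_le[OF assms(2) f(1)])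
      also have "\<dots> \<le> 1 * wnorm G v f"
        using big by (intro mult_right_mono) (auto simp: norm_inverse inverse_le_1_iff)
      also have "\<dots> \<le> 1 / real (Suc j)" using f(2) by simp
      finally have "wnorm G v ?h \<le> 1 / real (Suc j)" .
      moreover have "f \<zeta> \<noteq> 0" using big by auto
      then have "cmod (?h \<zeta>) = 1" by simp
      moreover have "cmod (?h z) \<le> 1" if "z \<in> L" for z
      proof -
        have "cmod (?h z) = cmod (f z) / cmod (f \<zeta>)"
          by (simp add: norm_mult norm_inverse divide_inverse mult.commute)
        then show ?thesis using big \<zeta>(2)[OF that] by (simp add: divide_le_eq_1)
      qed
      ultimately show ?thesis
        using Hinf_scale[OF assms(2) f(1), of "inverse (f \<zeta>)"] \<zeta>(1)
        by (intro exI[of _ ?h] exI[of _ \<zeta>]) blast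
    qed
    then obtain h \<zeta> where h: "\<And>j. h j \<in> Hinf G v" and \<zeta>: "\<And>j::nat. \<zeta> j \<in> L" "\<And>j. cmod (h j (\<zeta> j)) = 1"
      and hL: "\<And>j z. z \<in> L \<Longrightarrow> cmod (h j z) \<le> 1" and hv: "\<And>j. wnorm G v (h j) \<le> 1 / real (Suc j)"
      by metis
    have hvz: "v z * cmod (h j z) \<le> 1 / real (Suc j)" if "z \<in> G" for z j
      using wnorm_upper[OF assms(2) h that] hv order_trans by blast
    have hw: "w z * cmod (h j z) \<le> C" if "z \<in> G" for z j
    proof (rule mixed[OF h])
      show "v z * cmod (h j z) \<le> 1" if "z \<in> G" for z
        using hvz[OF that, of j] by (rule order_trans) simp
    qed (use hL L0(3) that in auto)
    have locbd: "\<exists>B. \<forall>f\<in>range h. \<forall>z\<in>T. cmod (f z) \<le> B" if T: "compact T" "T \<subseteq> G" for T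
    proof -
      have "continuous_on T (\<lambda>z. C / w z)"
        using assms(6) T(2) wpos
        by (intro continuous_on_divide continuous_on_const) (auto intro: continuous_on_subset dest!: bspec)
      then have "bounded ((\<lambda>z. C / w z) ` T)"
        using T(1) compact_continuous_image compact_imp_bounded by blast
      then obtain B where B: "\<And>z. z \<in> T \<Longrightarrow> \<bar>C / w z\<bar> \<le> B" by (auto simp: bounded_iff)
      have "cmod (h j z) \<le> B" if "z \<in> T" for j z
      proof -
        have "cmod (h j z) \<le> C / w z"
          using hw[of z j] wpos that T(2) by (auto simp: pos_le_divide_eq mult.commute)
        then show ?thesis using B[OF that] by linarith
      qed
      then show ?thesis by blast
    qed
    obtain g r where g: "g holomorphic_on G" "strict_mono (r :: nat \<Rightarrow> nat)"
      "\<And>x. x \<in> G \<Longrightarrow> (\<lambda>j. h (r j) x) \<longlonglongrightarrow> g x"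
      "\<And>T. \<lbrakk>compact T; T \<subseteq> G\<rbrakk> \<Longrightarrow> uniform_limit T (h \<circ> r) g sequentially"
      using Montel[OF assms(1), of "range h" h] locbd Hinf_imp_holomorphic[OF h] by blast
    let ?g = "\<lambda>z. if z \<in> G then g z else 0"
    have "?g = (\<lambda>z. 0)"
    proof (rule Hinf_normed_eq_zero[OF assms(3)])
      have "?g holomorphic_on G" by (rule holomorphic_transform[OF g(1)]) simp
      then show "?g \<in> holo_space G" by (simp add: holo_space_def)
      fix z assume z: "z \<in> G"
      have "v z * cmod (g z) \<le> 0"
      proof (rule LIMSEQ_le)
        show "(\<lambda>j. v z * cmod (h (r j) z)) \<longlonglongrightarrow> v z * cmod (g z)"
          by (intro tendsto_intros g z)
        show "(\<lambda>j. 1 / real (Suc j)) \<longlonglongrightarrow> 0" by real_asymp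
        have "v z * cmod (h (r j) z) \<le> 1 / real (Suc j)" for j
        proof -
          have "1 / real (Suc (r j)) \<le> 1 / real (Suc j)"
            using strict_mono_imp_increasing[OF g(2), of j] by (simp add: frac_le)
          then show ?thesis using hvz[OF z, of "r j"] by linarith
        qed
        then show "\<exists>N. \<forall>j\<ge>N. v z * cmod (h (r j) z) \<le> 1 / real (Suc j)" by blast
      qed
      then show "v z * cmod (?g z) \<le> 0" using z by simp
    qed
    then have g0: "g z = 0" if "z \<in> G" for z using that by (metis (full_types))
    have "\<forall>\<^sub>F j in sequentially. \<forall>z\<in>L. dist ((h \<circ> r) j z) (g z) < 1"
      using g(4)[OF L0(1,2)] by (auto simp: uniform_limit_iff)
    then obtain j where "\<forall>z\<in>L. dist ((h \<circ> r) j z) (g z) < 1"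
      by (auto simp: eventually_sequentially)
    then have "dist (h (r j) (\<zeta> (r j))) (g (\<zeta> (r j))) < 1" using \<zeta>(1) by simp
    moreover have "\<zeta> (r j) \<in> G" using \<zeta>(1) L0(2) by blast
    ultimately show False using g0[of "\<zeta> (r j)"] \<zeta>(2)[of "r j"] by (simp add: dist_norm)
  qed note small = this
  show ?thesis
    unfolding controls_compacta_def
  proof (intro allI impI)
    fix L assume L: "compact L \<and> L \<subseteq> G"
    have "compact (L \<union> K n)" "L \<union> K n \<subseteq> G"
      using L K by (auto simp: exhaustion_def)
    then obtain \<delta> where "\<delta> > 0" "\<And>f z. \<lbrakk>f \<in> Hinf G v; wnorm G v f < \<delta>; z \<in> L\<rbrakk> \<Longrightarrow> cmod (f z) \<le> 1"
      using small[of "L \<union> K n"] by blast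
    from small_ball_bound_imp_control[OF assms(2,3) this(1), of L 1] this(2)
    show "\<exists>C. \<forall>f\<in>Hinf G v. \<forall>z\<in>L. cmod (f z) \<le> C * wnorm G v f" by blast
  qed
qed

theorem theorem2p6:
  fixes G :: "complex set" and v :: "complex \<Rightarrow> real"
  assumes "planar_domain G"
    and "weight_on G v"
    and "bounded (v ` G)"
    and "Hinf_normed G v"
  shows "Hinf_complete G v \<longleftrightarrow>
    (\<exists>w :: complex \<Rightarrow> real. weight_on G w \<and> bounded (w ` G) \<and> continuous_on G w \<and>
       (\<forall>z\<in>G. 0 < w z) \<and> Hinf G v = Hinf G w)"
proof -
  have "open G" using assms(1) by (simp add: planar_domain_def)
  show ?thesis
  proof
    assume "Hinf_complete G v"
    with \<open>open G\<close> assms(2,4) have "controls_compacta G v"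
      by (intro complete_imp_controls_compacta)
    with \<open>open G\<close> assms(2,3) show "\<exists>w :: complex \<Rightarrow> real. weight_on G w \<and> bounded (w ` G) \<and>
        continuous_on G w \<and> (\<forall>z\<in>G. 0 < w z) \<and> Hinf G v = Hinf G w"
      by (intro controls_compacta_imp_continuous_weight)
  next
    assume "\<exists>w :: complex \<Rightarrow> real. weight_on G w \<and> bounded (w ` G) \<and> continuous_on G w \<and>
        (\<forall>z\<in>G. 0 < w z) \<and> Hinf G v = Hinf G w"
    then have "controls_compacta G v"
      using equal_spaces_imp_controls_compacta[OF \<open>open G\<close> assms(2,4)] by blast
    then show "Hinf_complete G v"
      using controls_compacta_imp_complete[OF \<open>open G\<close> assms(2,4)] by blast
  qed
qed

end
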